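(* Let $\theta=\phi(D)$ be a delta operator with poweroids $x^{\{n\}}$ and let $\eta=\phi^{-1}(D)$. Put $e(x,t)=e^{x\eta}e^{0\cdot t}=\sum_{n\ge0}x^{\{n\}}\,t^n/n!$. Then $$e(x,t)\,e(y,t)=e(x+y,t),$$ equivalently the poweroids have the binomial property: for all $n\ge0$, $$(x+y)^{\{n\}}=\sum_{k=0}^n\binom nk\,x^{\{k\}}\,y^{\{n-k\}} .$$
   Context: Work with polynomials (real or complex coefficients); $D$ is differentiation. A delta operator is $\theta=\phi(D)$, where $\phi(t)=\sum_{\nu\ge1}k_\nu t^\nu$ is a formal power series with $k_1=1$; $\phi^{-1}$ is its compositional inverse. The poweroids $x^{\{n\}}$ of $\theta$ are the unique polynomials with $x^{\{0\}}=1$, $\theta x^{\{n\}}=n\,x^{\{n-1\}}$ for $n\ge1$, and $x^{\{n\}}|_{x=0}=0$ for $n\ge1$; $(x+y)^{\{n\}}$ is the polynomial $x^{\{n\}}$ evaluated at $x+y$. For a formal power series $f$, $f(\eta)0^n=\big(f(\phi^{-1}(D_z))z^n\big)|_{z=0}$, and $f(\eta)e^{0\cdot t}=\sum_{n\ge0}\big(f(\eta)0^n\big)t^n/n!$; in $e^{x\eta}$, $x$ is a parameter. All series are formal power series in $t$. *)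

theory Defs
  imports "HOL-Computational_Algebra.Computational_Algebra"
begin

(* f(T) p = (SUM k. f_k T^k p).  Meant only for linear operators T that lower degrees:
   then T^k p = 0 for k > degree p, so the truncated sum is the whole series. *)
definition op_series ::
    "'a::field_char_0 fps \<Rightarrow> ('a poly \<Rightarrow> 'a poly) \<Rightarrow> 'a poly \<Rightarrow> 'a poly" where
  "op_series f T p = (\<Sum>k\<le>degree p. smult (fps_nth f k) ((T ^^ k) p))"

definition delta_series :: "'a::field_char_0 fps \<Rightarrow> bool" where
  "delta_series \<phi> \<longleftrightarrow> fps_nth \<phi> 0 = 0 \<and> fps_nth \<phi> 1 = 1"

definition is_poweroids ::
    "('a::field_char_0 poly \<Rightarrow> 'a poly) \<Rightarrow> (nat \<Rightarrow> 'a poly) \<Rightarrow> bool" where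
  "is_poweroids \<theta> p \<longleftrightarrow>
     p 0 = 1 \<and>
     (\<forall>n\<ge>1. \<theta> (p n) = smult (of_nat n) (p (n - 1))) \<and>
     (\<forall>n\<ge>1. poly (p n) 0 = 0)"

(* Existence and uniqueness, for delta operators, are proved in ex1_poweroids below. *)
definition poweroid :: "('a::field_char_0 poly \<Rightarrow> 'a poly) \<Rightarrow> nat \<Rightarrow> 'a poly" where
  "poweroid \<theta> = (THE p. is_poweroids \<theta> p)"

(* f(eta) 0^n *)
definition zero_power :: "('a::field_char_0 poly \<Rightarrow> 'a poly) \<Rightarrow> 'a fps \<Rightarrow> nat \<Rightarrow> 'a" where
  "zero_power \<eta> f n = poly (op_series f \<eta> (monom 1 n)) 0"

(* f(eta) e^(0 t), a formal power series in t *)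
definition zero_exp :: "('a::field_char_0 poly \<Rightarrow> 'a poly) \<Rightarrow> 'a fps \<Rightarrow> 'a fps" where
  "zero_exp \<eta> f = Abs_fps (\<lambda>n. zero_power \<eta> f n / fact n)"

lemma higher_pderiv_eq_0:
  fixes p :: "'a::field_char_0 poly"
  assumes "degree p < n"
  shows "(pderiv ^^ n) p = 0"
  using assms
proof (induction n arbitrary: p)
  case (Suc n)
  show ?case
  proof (cases "degree p = 0")
    case True
    then have "pderiv p = 0" by (simp add: pderiv_eq_0_iff)
    then show ?thesis by (simp del: funpow.simps add: funpow_Suc_right)
  next
    case False
    then have "degree (pderiv p) < n" using Suc.prems by (simp add: degree_pderiv)
    then show ?thesis using Suc.IH by (simp del: funpow.simps add: funpow_Suc_right)
  qed
qed simp

lemma op_series_pderiv_atMost: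
  assumes "degree p \<le> N"
  shows "op_series f pderiv p = (\<Sum>k\<le>N. smult (fps_nth f k) ((pderiv ^^ k) p))"
  unfolding op_series_def using assms
  by (intro sum.mono_neutral_left) (auto simp: higher_pderiv_eq_0)

lemma degree_op_series_pderiv: "degree (op_series f pderiv p) \<le> degree p"
  unfolding op_series_def
  by (intro degree_sum_le) (auto simp: degree_higher_pderiv)

lemma smult_sum_poly: "smult c (sum g A) = (\<Sum>i\<in>A. smult c (g i))"
  by (induction A rule: infinite_finite_induct) (auto simp: smult_add_right)

lemma op_series_pderiv_mult:
  "op_series f pderiv (op_series g pderiv p) = op_series (f * g) pderiv p"
proof -
  define N where "N = degree p"
  let ?h = "\<lambda>i j. smult (fps_nth f i * fps_nth g j) ((pderiv ^^ (i + j)) p)"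
  have "op_series f pderiv (op_series g pderiv p) = (\<Sum>i\<le>N. \<Sum>j\<le>N. ?h i j)"
    using op_series_pderiv_atMost[OF degree_op_series_pderiv, of f g p]
    by (simp add: N_def op_series_def[of g] higher_pderiv_sum higher_pderiv_smult
        smult_sum_poly funpow_add)
  also have "\<dots> = (\<Sum>(i,j)\<in>{..N} \<times> {..N}. ?h i j)"
    by (simp add: sum.cartesian_product)
  also have "\<dots> = (\<Sum>(i,j)\<in>{(i,j). i + j \<le> N}. ?h i j)"
    by (rule sum.mono_neutral_right) (auto simp: N_def, metis higher_pderiv_eq_0 not_le)
  also have "\<dots> = (\<Sum>k\<le>N. \<Sum>i\<le>k. ?h i (k - i))"
    by (rule sum.triangle_reindex_eq)
  also have "\<dots> = op_series (f * g) pderiv p"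
    by (simp add: op_series_def N_def fps_mult_nth smult_sum atLeast0AtMost)
  finally show ?thesis .
qed

lemma op_series_pderiv_diff:
  "op_series f pderiv (p - q) = op_series f pderiv p - op_series f pderiv q"
proof -
  define N where "N = max (degree p) (degree q)"
  have "degree (p - q) \<le> N" "degree p \<le> N" "degree q \<le> N"
    by (auto simp: N_def degree_diff_le_max)
  moreover have "(pderiv ^^ k) (p - q) = (pderiv ^^ k) p - (pderiv ^^ k) q" for k
    by (induction k) (auto simp: pderiv_diff)
  ultimately show ?thesis
    by (simp add: op_series_pderiv_atMost[of _ N] smult_diff_right sum_subtractf)
qed

lemma op_series_pderiv_1: "op_series 1 pderiv p = p"
proof -
  have "op_series 1 pderiv p = (\<Sum>k\<in>{0}. smult (fps_nth 1 k) ((pderiv ^^ k) p))"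
    unfolding op_series_def by (rule sum.mono_neutral_right) auto
  then show ?thesis by simp
qed

lemma op_series_pderiv_X: "op_series fps_X pderiv p = pderiv p"
proof -
  have "op_series fps_X pderiv p = (\<Sum>k\<le>Suc (degree p). smult (fps_nth fps_X k) ((pderiv ^^ k) p))"
    by (rule op_series_pderiv_atMost) simp
  also have "\<dots> = (\<Sum>k\<in>{1}. smult (fps_nth fps_X k) ((pderiv ^^ k) p))"
    by (rule sum.mono_neutral_right) (auto simp: fps_X_def)
  finally show ?thesis by simp
qed

lemma surj_pderiv: "\<exists>q. pderiv q = (p :: 'a::field_char_0 poly)"
proof
  let ?q = "\<Sum>i\<le>degree p. monom (coeff p i / of_nat (Suc i)) (Suc i)"
  have "pderiv ?q = (\<Sum>i\<le>degree p. monom (coeff p i) i)"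
    using higher_pderiv_sum[of 1 "\<lambda>i. monom (coeff p i / of_nat (Suc i)) (Suc i)" "{..degree p}"]
    by (simp add: pderiv_monom del: of_nat_Suc)
  then show "pderiv ?q = p" by (simp add: poly_as_sum_of_monoms)
qed

lemma delta_operator_factor:
  fixes \<phi> :: "'a::field_char_0 fps"
  assumes "delta_series \<phi>"
  obtains u where "\<phi> = fps_X * u" "fps_nth u 0 = 1"
proof
  show "\<phi> = fps_X * fps_shift 1 \<phi>"
    using assms fps_shift_times_fps_X'[of \<phi>] 
    by (simp add: fps_eq_iff delta_series_def)
  show "fps_nth (fps_shift 1 \<phi>) 0 = 1" using assms by (simp add: delta_series_def)
qed

lemma surj_delta_operator:
  assumes "delta_series \<phi>"
  shows "\<exists>q. op_series \<phi> pderiv q = p"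
proof -
  from assms obtain u where u: "\<phi> = fps_X * u" "fps_nth u 0 = 1"
    by (rule delta_operator_factor)
  obtain r where "pderiv r = p" using surj_pderiv by blast
  moreover have "\<phi> * inverse u = fps_X"
    using u by (simp add: inverse_mult_eq_1' mult.assoc)
  ultimately have "op_series \<phi> pderiv (op_series (inverse u) pderiv r) = p"
    by (simp add: op_series_pderiv_mult op_series_pderiv_X)
  then show ?thesis by blast
qed

lemma op_series_pderiv_const: "op_series f pderiv [:c:] = [:fps_nth f 0 * c:]"
  by (simp add: op_series_def)

lemma kernel_delta_operator:
  assumes "delta_series \<phi>" "op_series \<phi> pderiv p = 0"
  shows "\<exists>c. p = [:c:]"
proof -
  from assms obtain u where u: "\<phi> = fps_X * u" "fps_nth u 0 = 1"
    by (blast intro: delta_operator_factor)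
  then have "pderiv (op_series u pderiv p) = 0"
    using assms by (simp add: op_series_pderiv_mult flip: op_series_pderiv_X)
  then obtain c where c: "op_series u pderiv p = [:c:]"
    by (auto simp: pderiv_eq_0_iff elim: degree_eq_zeroE)
  have "p = op_series (inverse u * u) pderiv p"
    using u by (simp add: inverse_mult_eq_1 op_series_pderiv_1)
  also have "\<dots> = op_series (inverse u) pderiv [:c:]"
    by (simp add: c flip: op_series_pderiv_mult)
  finally show ?thesis by (simp add: op_series_pderiv_const)
qed

lemma ex1_poweroids:
  assumes "delta_series \<phi>"
  shows "\<exists>!p. is_poweroids (op_series \<phi> pderiv) p"
proof -
  let ?\<theta> = "op_series \<phi> pderiv"
  have step: "\<exists>!q. ?\<theta> q = r \<and> poly q 0 = 0" for r
  proof -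
    obtain q where q: "?\<theta> q = r" using surj_delta_operator[OF assms] by blast
    have "?\<theta> (q - [:poly q 0:]) = r"
      using q assms by (simp add: op_series_pderiv_diff op_series_pderiv_const delta_series_def)
    moreover have "q1 = q2"
      if "?\<theta> q1 = r" "poly q1 0 = 0" "?\<theta> q2 = r" "poly q2 0 = 0" for q1 q2
    proof -
      have "?\<theta> (q1 - q2) = 0" using that by (simp add: op_series_pderiv_diff)
      then obtain c where c: "q1 - q2 = [:c:]" using kernel_delta_operator[OF assms] by blast
      have "poly (q1 - q2) 0 = 0" using that by simp
      then have "c = 0" by (simp add: c)
      then show ?thesis using c by simp
    qed
    ultimately show ?thesis by (intro ex1I[of _ "q - [:poly q 0:]"]) auto
  qed
  define p where
    "p = rec_nat 1 (\<lambda>n r. THE q. ?\<theta> q = smult (of_nat (Suc n)) r \<and> poly q 0 = 0)"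
  have p_Suc: "?\<theta> (p (Suc n)) = smult (of_nat (Suc n)) (p n) \<and> poly (p (Suc n)) 0 = 0" for n
    using theI'[OF step[of "smult (of_nat (Suc n)) (p n)"]] by (simp add: p_def)
  have p: "is_poweroids ?\<theta> p"
    unfolding is_poweroids_def
  proof (intro conjI allI impI)
    show "p 0 = 1" by (simp add: p_def)
    fix n :: nat assume "n \<ge> 1"
    then obtain m where "n = Suc m" by (cases n) auto
    then show "?\<theta> (p n) = smult (of_nat n) (p (n - 1))" "poly (p n) 0 = 0"
      using p_Suc by auto
  qed
  moreover have "q = p" if q: "is_poweroids ?\<theta> q" for q
  proof
    fix n show "q n = p n"
    proof (induction n)
      case 0
      then show ?case using p q by (simp add: is_poweroids_def)
    next
      case (Suc n)
      have "?\<theta> (q (Suc n)) = smult (of_nat (Suc n)) (q n)" "poly (q (Suc n)) 0 = 0"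
        using q unfolding is_poweroids_def by (metis diff_Suc_1 le_add1 plus_1_eq_Suc)+
      then show ?case
        using step[of "smult (of_nat (Suc n)) (p n)"] p_Suc[of n] Suc by metis
    qed
  qed
  ultimately show ?thesis by blast
qed

end

theory Submission
  imports Defs
begin

text \<open>With \<open>\<psi>\<close> the compositional inverse of \<open>\<phi>\<close>, the series \<open>e(x,t)\<close> equals \<open>exp(x \<psi>(t))\<close>, which is
  multiplicative in \<open>x\<close>. Each derivative in \<open>x\<close> multiplies \<open>exp(x \<psi>(t))\<close> by \<open>\<psi>(t)\<close>, so \<open>\<phi>(D)\<close>
  multiplies it by \<open>\<phi>(\<psi>(t)) = t\<close>; hence its coefficients, scaled by \<open>n!\<close>, satisfy the
  defining recurrence of the poweroids.\<close>

text \<open>Since \<open>c ^ j\<close> has no terms below degree j, only j \<le> n can contribute.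
  The common bound n matches the truncation in \<open>op_series\<close> on polynomials of degree at
  most n.\<close>

lemma fps_compose_mult_nth:
  fixes a c f :: "'a::idom fps"
  assumes "fps_nth c 0 = 0"
  shows "fps_nth ((a oo c) * f) n = (\<Sum>j\<le>n. fps_nth a j * fps_nth (c ^ j * f) n)"
proof -
  \<comment> \<open>Padding the range from m to n with zero terms makes the two sums
    independent.\<close>
  have "fps_nth (a oo c) m = (\<Sum>j\<le>n. fps_nth a j * fps_nth (c ^ j) m)" if "m \<le> n" for m
    unfolding fps_compose_nth using that assms
    by (intro sum.mono_neutral_left) (auto simp: startsby_zero_power_prefix)
  then have "fps_nth ((a oo c) * f) n =
      (\<Sum>m=0..n. \<Sum>j\<le>n. fps_nth a j * fps_nth (c ^ j) m * fps_nth f (n - m))"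
    by (simp add: fps_mult_nth sum_distrib_right)
  also have "\<dots> = (\<Sum>j\<le>n. \<Sum>m=0..n. fps_nth a j * fps_nth (c ^ j) m * fps_nth f (n - m))"
    by (rule sum.swap)
  finally show ?thesis
    by (simp add: fps_mult_nth sum_distrib_left mult.assoc)
qed

lemma fps_mult_power_nth_eq_0:
  fixes f c :: "'a::idom fps"
  assumes "fps_nth c 0 = 0" "n < k"
  shows "fps_nth (f * c ^ k) n = 0"
  using assms by (auto simp: fps_mult_nth startsby_zero_power_prefix intro!: sum.neutral)

lemma funpow_op_series_pderiv:
  "(op_series g pderiv ^^ k) p = op_series (g ^ k) pderiv p"
  by (induction k) (simp_all add: op_series_pderiv_1 op_series_pderiv_mult)

text \<open>At 0 only the n-th derivative of the monomial survives, with value n!.\<close>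

lemma poly_op_series_pderiv_monom_0:
  "poly (op_series g pderiv (monom 1 n)) 0 = fact n * fps_nth g n"
  by (simp add: op_series_def degree_monom_eq poly_0_coeff_0 coeff_sum coeff_higher_pderiv
      pochhammer_fact if_distrib mult_ac cong: if_cong)

lemma zero_exp_op_series_pderiv:
  fixes g f :: "'a::field_char_0 fps"
  assumes "fps_nth g 0 = 0"
  shows "zero_exp (op_series g pderiv) f = f oo g"
proof (rule fps_ext)
  fix n
  have "zero_power (op_series g pderiv) f n = (\<Sum>k\<le>n. fps_nth f k * (fact n * fps_nth (g ^ k) n))"
    by (simp add: zero_power_def op_series_def[of f] degree_monom_eq poly_sum
        funpow_op_series_pderiv poly_op_series_pderiv_monom_0)
  also have "\<dots> = fact n * fps_nth (f oo g) n"
    by (simp add: fps_compose_nth sum_distrib_left atLeast0AtMost mult_ac)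
  finally show "fps_nth (zero_exp (op_series g pderiv) f) n = fps_nth (f oo g) n"
    by (simp add: zero_exp_def)
qed

text \<open>The coefficient of \<open>t\<^sup>n\<close> in \<open>f(t) exp(x g(t))\<close>, as a polynomial in \<open>x\<close>.\<close>

definition exp_coeff :: "'a::field_char_0 fps \<Rightarrow> 'a fps \<Rightarrow> nat \<Rightarrow> 'a poly" where
  "exp_coeff g f n = (\<Sum>k\<le>n. monom (fps_nth (f * g ^ k) n / fact k) k)"

context
  fixes g :: "'a::field_char_0 fps"
  assumes g0: "fps_nth g 0 = 0"
begin

text \<open>Holds also for k > n: there \<open>g ^ k\<close> starts beyond degree n, so both sides
  vanish.\<close>

lemma coeff_exp_coeff: "coeff (exp_coeff g f n) k = fps_nth (f * g ^ k) n / fact k"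
  by (auto simp: exp_coeff_def coeff_sum fps_mult_power_nth_eq_0[OF g0])

lemma degree_exp_coeff: "degree (exp_coeff g f n) \<le> n"
  by (intro degree_le) (auto simp: coeff_exp_coeff fps_mult_power_nth_eq_0[OF g0])

lemma poly_exp_coeff: "poly (exp_coeff g f n) x = fps_nth ((fps_exp x oo g) * f) n"
  unfolding fps_compose_mult_nth[OF g0]
  by (simp add: exp_coeff_def poly_sum poly_monom mult_ac)

lemma higher_pderiv_exp_coeff: "(pderiv ^^ j) (exp_coeff g f n) = exp_coeff g (g ^ j * f) n"
proof (induction j)
  case (Suc j)
  \<comment> \<open>The factor k + 1 from differentiation turns 1/(k+1)! into 1/k!, leaving one
    extra factor g.\<close>
  have "pderiv (exp_coeff g h n) = exp_coeff g (g * h) n" for h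
    by (rule poly_eqI) (simp add: coeff_pderiv coeff_exp_coeff mult_ac del: of_nat_Suc)
  with Suc show ?case by (simp add: mult_ac)
qed simp

text \<open>As a function of x, exp(x g(t)) is an eigenfunction of D with eigenvalue g(t), hence of
  a(D) with eigenvalue a(g(t)).\<close>

lemma op_series_pderiv_exp_coeff:
  "op_series a pderiv (exp_coeff g f n) = exp_coeff g ((a oo g) * f) n"
proof (rule poly_eqI)
  fix k
  have "coeff (op_series a pderiv (exp_coeff g f n)) k =
      (\<Sum>j\<le>n. fps_nth a j * fps_nth (g ^ j * (f * g ^ k)) n) / fact k"
    by (simp add: op_series_pderiv_atMost[OF degree_exp_coeff] coeff_sum higher_pderiv_exp_coeff
        coeff_exp_coeff sum_divide_distrib mult_ac)
  then show "coeff (op_series a pderiv (exp_coeff g f n)) k = coeff (exp_coeff g ((a oo g) * f) n) k"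
    by (simp add: coeff_exp_coeff fps_compose_mult_nth[OF g0, symmetric] mult.assoc)
qed

end

lemma poweroid_eq_exp_coeff:
  assumes \<phi>: "delta_series \<phi>"
  shows "poweroid (op_series \<phi> pderiv) n = smult (fact n) (exp_coeff (fps_inv \<phi>) 1 n)"
proof -
  let ?\<psi> = "fps_inv \<phi>" and ?\<theta> = "op_series \<phi> pderiv"
  define p where "p n = smult (fact n) (exp_coeff ?\<psi> 1 n)" for n
  have \<psi>0: "fps_nth ?\<psi> 0 = 0" by (simp add: fps_inv_def)
  have inv: "\<phi> oo ?\<psi> = fps_X" using \<phi> by (simp add: fps_inv_right delta_series_def)
  have "is_poweroids ?\<theta> p"
    unfolding is_poweroids_def
  proof (intro conjI allI impI)
    show "p 0 = 1" by (simp add: p_def exp_coeff_def)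
    fix n :: nat assume n: "n \<ge> 1"
    then show "poly (p n) 0 = 0"
      by (simp add: p_def poly_0_coeff_0 coeff_exp_coeff[OF \<psi>0])
    \<comment> \<open>The eigenvalue of \<theta> is t itself, and multiplying by t lowers the
      coefficient index by one.\<close>
    have shift: "exp_coeff ?\<psi> fps_X n = exp_coeff ?\<psi> 1 (n - 1)"
      using n by (intro poly_eqI) (simp add: coeff_exp_coeff[OF \<psi>0])
    have smult: "?\<theta> (smult c q) = smult c (?\<theta> q)" for c q
      by (simp add: op_series_def higher_pderiv_smult smult_sum_poly mult.commute)
    show "?\<theta> (p n) = smult (of_nat n) (p (n - 1))"
      using n by (simp add: p_def smult op_series_pderiv_exp_coeff[OF \<psi>0] inv shift fact_reduce)
  qed
  then have "poweroid ?\<theta> = p"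
    unfolding poweroid_def by (rule the1_equality[OF ex1_poweroids[OF \<phi>]])
  then show ?thesis by (simp add: p_def)
qed

theorem mainTheorem5:
  fixes \<phi> :: "'a::field_char_0 fps"
    and \<theta> \<eta> :: "'a poly \<Rightarrow> 'a poly"
    and e :: "'a \<Rightarrow> 'a fps"
  assumes "delta_series \<phi>"
    and "\<theta> = op_series \<phi> pderiv"
    and "\<eta> = op_series (fps_inv \<phi>) pderiv"
    and "\<And>x. e x = zero_exp \<eta> (fps_exp x)"
  shows "(\<forall>x. e x = Abs_fps (\<lambda>n. poly (poweroid \<theta> n) x / fact n)) \<and>
         (\<forall>x y. e x * e y = e (x + y)) \<and>
         (\<forall>n x y. poly (poweroid \<theta> n) (x + y) =
            (\<Sum>k=0..n. of_nat (n choose k) * poly (poweroid \<theta> k) x * poly (poweroid \<theta> (n - k)) y))"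
proof (intro conjI allI)
  have \<psi>0: "fps_nth (fps_inv \<phi>) 0 = 0" by (simp add: fps_inv_def)
  have e: "e x = fps_exp x oo fps_inv \<phi>" for x
    using assms(3,4) by (simp add: zero_exp_op_series_pderiv[OF \<psi>0])
  have poweroid: "poly (poweroid \<theta> n) x = fact n * fps_nth (e x) n" for n x
    using assms(1,2) by (simp add: poweroid_eq_exp_coeff poly_exp_coeff[OF \<psi>0] e)
  then show "e x = Abs_fps (\<lambda>n. poly (poweroid \<theta> n) x / fact n)" for x
    by (simp add: fps_eq_iff)
  \<comment> \<open>Substituting a series without constant term respects products.\<close>
  show mult: "e x * e y = e (x + y)" for x y
    by (simp add: e fps_exp_add_mult fps_compose_mult_distrib[OF \<psi>0])
  fix n x y
  have "poly (poweroid \<theta> n) (x + y) = (\<Sum>k=0..n. fact n * (fps_nth (e x) k * fps_nth (e y) (n - k)))"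
    by (simp add: poweroid flip: mult) (simp add: fps_mult_nth sum_distrib_left)
  \<comment> \<open>Splits n! into the binomial coefficient times k! (n-k)!, which rescales both
    factors to poweroids.\<close>
  also have "\<dots> = (\<Sum>k=0..n. of_nat (n choose k) * poly (poweroid \<theta> k) x * poly (poweroid \<theta> (n - k)) y)"
    by (intro sum.cong refl) (simp add: poweroid binomial_fact field_simps)
  finally show "poly (poweroid \<theta> n) (x + y) =
      (\<Sum>k=0..n. of_nat (n choose k) * poly (poweroid \<theta> k) x * poly (poweroid \<theta> (n - k)) y)" .
qed

end
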